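(* Let $W$ be a weight matrix of size $N$, and let $\mathcal Z(W)$ be the center of $\mathcal D(W)$. Suppose that for every $n\ge0$ there exists an operator $C_n\in\mathcal Z(W)$ such that $\Lambda_k(C_n)$ is a scalar matrix for every $k\ge0$ and such that $\Lambda_k(C_n)=\Lambda_n(C_n)$ only if $k=n$. Then $$C_{\mathbf D}(\mathcal Z(W))=\mathcal D(W).$$
   Context: A weight matrix $W$ of size $N$ is an integrable complex $N\times N$ matrix-valued function on a real interval $(a,b)$ (possibly infinite) that is positive definite almost everywhere and has finite moments of all orders. $M_N$ denotes complex $N\times N$ matrices, $T^*$ the conjugate transpose. On $M_N[x]$ use the matrix-valued form $(P,Q)=\int_a^b P(x)W(x)Q(x)^*\,dx$; $\{Q_w\}_{w\ge0}$ is the unique sequence of monic orthogonal polynomials ($Q_w\in M_N[x]$ monic of degree $w$, $(Q_w,Q_{w'})=0$ for $w\ne w'$). The Weyl algebra over $M_N$ is $$\mathbf D=\Bigl\{D=\sum_{i=0}^s\partial^iF_i:\ F_i\in M_N[x]\Bigr\},\quad \partial=\tfrac{d}{dx},$$ whose elements act on $M_N[x]$ on the right by $PD=\sum_i\partial^i(P)F_i$, with product determined by $P(DE)=(PD)E$. Its subalgebra $\mathcal D(W)$ consists of the $D\in\mathbf D$ such that for every $w\ge0$ there is a (necessarily unique) $\Lambda_w(D)\in M_N$ with $Q_wD=\Lambda_w(D)Q_w$. For a subset $S$ of $\mathbf D$, $C_{\mathbf D}(S)$ denotes the centralizer of $S$ in $\mathbf D$. A scalar matrix is a complex multiple of the identity.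 *)

theory Defs
  imports "HOL-Analysis.Analysis" "HOL-Computational_Algebra.Polynomial"
begin

section \<open>Matrix polynomials\<close>

text \<open>
  \<open>M\<^sub>N\<close> is \<open>complex ^ 'n ^ 'n\<close>, with \<open>N = CARD('n)\<close>.  A matrix polynomial is represented by
  the matrix of its entries, so that the product of \<open>M\<^sub>N[x]\<close> is the matrix product \<open>**\<close>
  over the ring \<open>complex poly\<close>.
\<close>

type_synonym 'n cmat = "((complex, 'n) vec, 'n) vec"
type_synonym 'n mat_poly = "((complex poly, 'n) vec, 'n) vec"

definition conj_transpose :: "('n::finite) cmat \<Rightarrow> 'n cmat" where
  "conj_transpose A = (\<chi> i j. cnj (A $ j $ i))"

definition mp_const :: "('n::finite) cmat \<Rightarrow> 'n mat_poly" where
  "mp_const A = (\<chi> i j. [:A $ i $ j:])"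

definition mp_eval :: "('n::finite) mat_poly \<Rightarrow> real \<Rightarrow> 'n cmat" where
  "mp_eval P x = (\<chi> i j. poly (P $ i $ j) (complex_of_real x))"

definition mp_coeff :: "('n::finite) mat_poly \<Rightarrow> nat \<Rightarrow> 'n cmat" where
  "mp_coeff P k = (\<chi> i j. coeff (P $ i $ j) k)"

definition mp_deriv :: "('n::finite) mat_poly \<Rightarrow> 'n mat_poly" where
  "mp_deriv P = (\<chi> i j. pderiv (P $ i $ j))"

definition mp_monic :: "nat \<Rightarrow> ('n::finite) mat_poly \<Rightarrow> bool" where
  "mp_monic w P \<longleftrightarrow> mp_coeff P w = mat 1 \<and> (\<forall>k>w. mp_coeff P k = 0)"


section \<open>Weight matrices and their monic orthogonal polynomials\<close>

definition positive_definite :: "('n::finite) cmat \<Rightarrow> bool" where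
  "positive_definite A \<longleftrightarrow> conj_transpose A = A \<and>
     (\<forall>v. v \<noteq> 0 \<longrightarrow> 0 < Re (\<Sum>i\<in>UNIV. \<Sum>j\<in>UNIV. cnj (v $ i) * A $ i $ j * v $ j))"

text \<open>
  The case \<open>k = 0\<close> of the moment condition is the integrability of \<open>W\<close>.
  \<open>W\<close> is a total function, but its values outside \<open>(a,b)\<close> are irrelevant.
\<close>

definition weight_matrix :: "ereal \<Rightarrow> ereal \<Rightarrow> (real \<Rightarrow> ('n::finite) cmat) \<Rightarrow> bool" where
  "weight_matrix a b W \<longleftrightarrow> a < b \<and>
     (\<forall>k. (\<lambda>x. x ^ k *\<^sub>R W x) absolutely_integrable_on einterval a b) \<and>
     (AE x in lebesgue. x \<in> einterval a b \<longrightarrow> positive_definite (W x))"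

definition mp_form ::
  "ereal \<Rightarrow> ereal \<Rightarrow> (real \<Rightarrow> ('n::finite) cmat) \<Rightarrow> 'n mat_poly \<Rightarrow> 'n mat_poly \<Rightarrow> 'n cmat" where
  "mp_form a b W P Q =
     (LINT x:einterval a b|lebesgue. mp_eval P x ** W x ** conj_transpose (mp_eval Q x))"

definition is_monic_ops ::
  "ereal \<Rightarrow> ereal \<Rightarrow> (real \<Rightarrow> ('n::finite) cmat) \<Rightarrow> (nat \<Rightarrow> 'n mat_poly) \<Rightarrow> bool" where
  "is_monic_ops a b W Q \<longleftrightarrow>
     (\<forall>w. mp_monic w (Q w)) \<and> (\<forall>w w'. w \<noteq> w' \<longrightarrow> mp_form a b W (Q w) (Q w') = 0)"

text \<open>
  For a weight matrix the sequence exists and is unique (Gram-Schmidt: every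
  \<open>(Q\<^sub>w, Q\<^sub>w)\<close> is positive definite).
\<close>

definition monic_ops ::
  "ereal \<Rightarrow> ereal \<Rightarrow> (real \<Rightarrow> ('n::finite) cmat) \<Rightarrow> nat \<Rightarrow> 'n mat_poly" where
  "monic_ops a b W = (THE Q. is_monic_ops a b W Q)"


section \<open>The Weyl algebra over the matrices\<close>

text \<open>
  The operator \<open>\<Sum>\<^sub>i \<partial>\<^sup>i F\<^sub>i\<close> is the polynomial in \<open>\<partial>\<close> with coefficients \<open>F\<^sub>i\<close>; only the
  additive structure of type \<open>poly\<close> is meaningful here.  The product of the Weyl algebra is
  \<open>weyl_mult\<close> below, not the operation \<open>*\<close> of that type.
\<close>

type_synonym 'n weyl = "(((complex poly, 'n) vec, 'n) vec) poly"

definition weyl_act :: "('n::finite) mat_poly \<Rightarrow> 'n weyl \<Rightarrow> 'n mat_poly" where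
  "weyl_act P D = (\<Sum>i\<le>degree D. (mp_deriv ^^ i) P ** coeff D i)"

text \<open>
  With right actions the Leibniz rule reads
  \<open>F \<partial>\<^sup>j = \<Sum>\<^sub>k (j choose k) \<partial>\<^sup>k F\<^sup>(\<^sup>j\<^sup>-\<^sup>k\<^sup>)\<close>.  The lemmas \<open>weyl_act_mult\<close> and \<open>weyl_act_inject\<close>
  show that the resulting product is the one determined by \<open>P (D E) = (P D) E\<close>.
\<close>

definition weyl_mult :: "('n::finite) weyl \<Rightarrow> 'n weyl \<Rightarrow> 'n weyl" where
  "weyl_mult D E =
     (\<Sum>j\<le>degree E. \<Sum>i\<le>degree D. \<Sum>k\<le>j.
        monom (mat (of_nat (j choose k)) ** ((mp_deriv ^^ (j - k)) (coeff D i) ** coeff E j)) (i + k))"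

lemma matrix_add_rdistrib': "(A + B) ** C = A ** C + B ** (C :: 'a::semiring_1^'n^'n)"
  by (vector matrix_matrix_mult_def sum.distrib[symmetric] field_simps)

lemma matrix_sum_left: "sum f S ** C = (\<Sum>i\<in>S. f i ** (C :: 'a::semiring_1^'n^'n))"
  by (induction S rule: infinite_finite_induct) (auto simp: matrix_add_rdistrib')

lemma matrix_sum_right: "(C :: 'a::semiring_1^'n^'n) ** sum f S = (\<Sum>i\<in>S. C ** f i)"
  by (induction S rule: infinite_finite_induct) (auto simp: matrix_add_ldistrib)

lemma mp_deriv_0 [simp]: "mp_deriv 0 = 0"
  by (simp add: mp_deriv_def vec_eq_iff)

lemma mp_deriv_add: "mp_deriv (A + B) = mp_deriv A + mp_deriv B"
  by (simp add: mp_deriv_def vec_eq_iff pderiv_add)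

lemma mp_deriv_funpow_add:
  "(mp_deriv ^^ n) (A + B) = (mp_deriv ^^ n) A + (mp_deriv ^^ n) B"
  by (induction n) (auto simp: mp_deriv_add)

lemma mp_deriv_funpow_0 [simp]: "(mp_deriv ^^ n) 0 = 0"
  by (induction n) auto

lemma mp_deriv_funpow_sum: "(mp_deriv ^^ n) (sum f S) = (\<Sum>i\<in>S. (mp_deriv ^^ n) (f i))"
  by (induction S rule: infinite_finite_induct) (auto simp: mp_deriv_funpow_add)

lemma mp_deriv_sum: "mp_deriv (sum f S) = (\<Sum>i\<in>S. mp_deriv (f i))"
  using mp_deriv_funpow_sum[of 1 f S] by simp

lemma mp_deriv_mult: "mp_deriv (A ** B) = mp_deriv A ** B + A ** mp_deriv B"
  by (simp add: mp_deriv_def vec_eq_iff matrix_matrix_mult_def higher_pderiv_sum[where n=1, simplified]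
      pderiv_mult sum.distrib[symmetric] algebra_simps)

lemma mat_mult_left:
  "mat c ** (A :: 'a::semiring_1^'n^'m) = (\<chi> i j. c * A $ i $ j)"
  by (simp add: mat_def matrix_matrix_mult_def vec_eq_iff if_distrib if_distribR cong: if_cong)

lemma mp_deriv_of_nat_mult:
  "mp_deriv (mat (of_nat m) ** A) = mat (of_nat m) ** mp_deriv A"
  by (simp add: mat_mult_left mp_deriv_def vec_eq_iff pderiv_mult)

lemma of_nat_mult_left_commute:
  "A ** (mat (of_nat m) ** B) = mat (of_nat m) ** (A ** (B :: 'a::comm_semiring_1^'n^'n))"
  unfolding mat_mult_left
  by (simp add: matrix_matrix_mult_def vec_eq_iff sum_distrib_left mult.left_commute)

lemma mp_deriv_leibniz:
  "(mp_deriv ^^ n) (A ** B) =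
     (\<Sum>k\<le>n. mat (of_nat (n choose k)) ** ((mp_deriv ^^ k) A ** (mp_deriv ^^ (n - k)) B))"
proof (induction n)
  case (Suc n)
  let ?T = "\<lambda>c i j. mat (of_nat c) ** ((mp_deriv ^^ i) A ** (mp_deriv ^^ j) B)"
  have T_add: "mat c ** X + mat d ** X = mat (c + d) ** X" for c d and X :: "'a mat_poly"
    by (simp add: mat_mult_left vec_eq_iff algebra_simps)
  have "(mp_deriv ^^ Suc n) (A ** B) =
        (\<Sum>k\<le>n. ?T (n choose k) (Suc k) (n - k)) + (\<Sum>k\<le>n. ?T (n choose k) k (Suc n - k))"
    by (simp add: Suc mp_deriv_sum mp_deriv_of_nat_mult)
      (simp add: mp_deriv_mult matrix_add_ldistrib sum.distrib Suc_diff_le)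
  also have "(\<Sum>k\<le>n. ?T (n choose k) k (Suc n - k)) =
      ?T 1 0 (Suc n) + (\<Sum>k\<le>n. ?T (n choose Suc k) (Suc k) (n - k))"
  proof -
    have "(\<Sum>k\<le>n. ?T (n choose k) k (Suc n - k)) = (\<Sum>k\<le>Suc n. ?T (n choose k) k (Suc n - k))"
      by (simp add: mat_mult_left vec_eq_iff)
    also have "\<dots> = ?T 1 0 (Suc n) + (\<Sum>k\<le>n. ?T (n choose Suc k) (Suc k) (n - k))"
      by (subst sum.atMost_Suc_shift) simp
    finally show ?thesis .
  qed
  finally show ?case
    by (subst sum.atMost_Suc_shift) (simp add: sum.distrib[symmetric] T_add add.left_commute)
qed (simp add: mat_mult_left vec_eq_iff)

lemma weyl_act_altdef:
  assumes "degree D \<le> m"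
  shows "weyl_act P D = (\<Sum>i\<le>m. (mp_deriv ^^ i) P ** coeff D i)"
  unfolding weyl_act_def using assms
  by (intro sum.mono_neutral_left) (auto simp: coeff_eq_0)

lemma weyl_act_0 [simp]: "weyl_act P 0 = 0"
  by (simp add: weyl_act_def)

lemma weyl_act_add: "weyl_act P (D + E) = weyl_act P D + weyl_act P E"
proof -
  let ?m = "max (degree D) (degree E)"
  show ?thesis
    using weyl_act_altdef[of D ?m P] weyl_act_altdef[of E ?m P]
      weyl_act_altdef[of "D + E" ?m P] degree_add_le_max[of D E]
    by (simp add: matrix_add_ldistrib sum.distrib)
qed

lemma weyl_act_sum: "weyl_act P (sum f S) = (\<Sum>i\<in>S. weyl_act P (f i))"
  by (induction S rule: infinite_finite_induct) (auto simp: weyl_act_add)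

lemma weyl_act_monom: "weyl_act P (monom F i) = (mp_deriv ^^ i) P ** F"
proof -
  have "weyl_act P (monom F i) = (\<Sum>k\<le>i. if k = i then (mp_deriv ^^ k) P ** F else 0)"
    by (subst weyl_act_altdef[OF degree_monom_le], intro sum.cong) auto
  thus ?thesis by simp
qed

lemma weyl_act_mult: "weyl_act P (weyl_mult D E) = weyl_act (weyl_act P D) E"
proof -
  have "(mp_deriv ^^ j) ((mp_deriv ^^ i) P ** F) ** G =
      (\<Sum>k\<le>j. (mp_deriv ^^ (i + k)) P **
        (mat (of_nat (j choose k)) ** ((mp_deriv ^^ (j - k)) F ** G)))"
    for i j and F G :: "'a mat_poly"
    unfolding mp_deriv_leibniz matrix_sum_left
    by (intro sum.cong refl, subst of_nat_mult_left_commute)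
      (simp add: matrix_mul_assoc add.commute[of i] funpow_add)
  thus ?thesis
    unfolding weyl_mult_def weyl_act_sum weyl_act_monom
    by (simp add: weyl_act_def[of _ E] weyl_act_def[of _ D] mp_deriv_funpow_sum matrix_sum_left)
qed

lemma mp_deriv_funpow_nth: "(mp_deriv ^^ i) A $ r $ s = (pderiv ^^ i) (A $ r $ s)"
  by (induction i) (auto simp: mp_deriv_def)

lemma mp_deriv_funpow_monom:
  "(mp_deriv ^^ i) (mat (monom 1 n) :: ('n::finite) mat_poly) =
     (if i \<le> n then mat (monom (of_nat (pochhammer (n - i + 1) i)) (n - i)) else 0)"
proof -
  have "(mp_deriv ^^ i) (mat (monom 1 n) :: 'n mat_poly) = mat ((pderiv ^^ i) (monom 1 n))"
    by (simp add: mat_def vec_eq_iff mp_deriv_funpow_nth)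
  moreover have "(pderiv ^^ i) (monom (1::complex) n) =
      (if i \<le> n then monom (of_nat (pochhammer (n - i + 1) i)) (n - i) else 0)"
    by (auto simp: poly_eq_iff coeff_higher_pderiv simp flip: pochhammer_of_nat)
  ultimately show ?thesis by (auto simp: mat_def vec_eq_iff)
qed

lemma weyl_act_inject:
  assumes "\<And>P. weyl_act P D = weyl_act P E"
  shows "D = E"
proof -
  define m where "m = max (degree D) (degree E)"
  have act: "(\<Sum>i\<le>m. (mp_deriv ^^ i) P ** coeff D i) = (\<Sum>i\<le>m. (mp_deriv ^^ i) P ** coeff E i)" for P
    using assms[of P] weyl_act_altdef[of D m P] weyl_act_altdef[of E m P] by (simp add: m_def)
  have "coeff D n = coeff E n" if "n \<le> m" for n
    using that
  proof (induction n rule: less_induct)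
    case (less n)
    let ?P = "mat (monom 1 n) :: 'a mat_poly"
    have split: "(\<Sum>i\<le>m. (mp_deriv ^^ i) ?P ** coeff X i) =
        (\<Sum>i<n. (mp_deriv ^^ i) ?P ** coeff X i) + (mp_deriv ^^ n) ?P ** coeff X n" for X :: "'a weyl"
    proof -
      have "(\<Sum>i\<le>m. (mp_deriv ^^ i) ?P ** coeff X i) = (\<Sum>i\<le>n. (mp_deriv ^^ i) ?P ** coeff X i)"
        using less.prems by (intro sum.mono_neutral_right) (auto simp: mp_deriv_funpow_monom)
      thus ?thesis by (simp flip: lessThan_Suc_atMost)
    qed
    have "(\<Sum>i<n. (mp_deriv ^^ i) ?P ** coeff D i) = (\<Sum>i<n. (mp_deriv ^^ i) ?P ** coeff E i)"
      using less by (intro sum.cong) auto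
    hence "(mp_deriv ^^ n) ?P ** coeff D n = (mp_deriv ^^ n) ?P ** coeff E n"
      using act[of ?P] by (simp add: split)
    moreover have "(mp_deriv ^^ n) ?P = mat (of_nat (fact n))"
      by (simp add: mp_deriv_funpow_monom pochhammer_fact monom_0 of_nat_poly)
    ultimately show ?case
      by (simp add: mat_mult_left vec_eq_iff)
  qed
  moreover have "coeff D n = coeff E n" if "n > m" for n
    using that by (simp add: m_def coeff_eq_0)
  ultimately show ?thesis
    by (metis poly_eqI not_le)
qed

definition centralizer :: "('n::finite) weyl set \<Rightarrow> 'n weyl set" where
  "centralizer S = {D. \<forall>E\<in>S. weyl_mult D E = weyl_mult E D}"


section \<open>The algebra \<open>\<D>(W)\<close>, its center, and the eigenvalue maps\<close>

definition D_alg :: "ereal \<Rightarrow> ereal \<Rightarrow> (real \<Rightarrow> ('n::finite) cmat) \<Rightarrow> 'n weyl set" where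
  "D_alg a b W =
     {D. \<forall>w. \<exists>L. weyl_act (monic_ops a b W w) D = mp_const L ** monic_ops a b W w}"

text \<open>
  The matrix \<open>L\<close> is unique because \<open>Q\<^sub>w\<close> is monic.  \<open>Lambda\<close> is meaningful only on \<open>D_alg a b W\<close>.
\<close>

definition Lambda ::
  "ereal \<Rightarrow> ereal \<Rightarrow> (real \<Rightarrow> ('n::finite) cmat) \<Rightarrow> nat \<Rightarrow> 'n weyl \<Rightarrow> 'n cmat" where
  "Lambda a b W w D =
     (THE L. weyl_act (monic_ops a b W w) D = mp_const L ** monic_ops a b W w)"

definition center :: "('n::finite) weyl set \<Rightarrow> 'n weyl set" where
  "center A = {D \<in> A. \<forall>E\<in>A. weyl_mult D E = weyl_mult E D}"

definition scalar_matrix :: "('n::finite) cmat \<Rightarrow> bool" where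
  "scalar_matrix A \<longleftrightarrow> (\<exists>c. A = mat c)"

end

theory Submission
  imports Defs
begin

text \<open>
  Only the inclusion of the centralizer of the center in \<open>\<D>(W)\<close> needs an argument.  Let \<open>D\<close> commute
  with the center and expand \<open>Q\<^sub>n D = \<Sum>\<^sub>k A\<^sub>k Q\<^sub>k\<close>.  Since \<open>D C\<^sub>n = C\<^sub>n D\<close> and the
  \<open>\<Lambda>\<^sub>k(C\<^sub>n) = c\<^sub>k\<close> are scalars, applying \<open>C\<^sub>n\<close> gives \<open>(c\<^sub>k - c\<^sub>n) A\<^sub>k = 0\<close>, so only the term
  \<open>k = n\<close> survives.  The form is definite because a nonzero polynomial has finitely many roots;
  this makes every \<open>(Q\<^sub>w, Q\<^sub>w)\<close> invertible, and Gram-Schmidt yields the \<open>Q\<^sub>w\<close>.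
\<close>

section \<open>Coefficients of matrix polynomials\<close>

lemma mp_eqI:
  assumes "\<And>k. mp_coeff P k = mp_coeff Q k"
  shows "P = Q"
  using assms by (simp add: mp_coeff_def vec_eq_iff poly_eq_iff)

lemma mp_coeff_0 [simp]: "mp_coeff 0 k = 0"
  by (simp add: mp_coeff_def vec_eq_iff)

lemma mp_coeff_add [simp]: "mp_coeff (P + Q) k = mp_coeff P k + mp_coeff Q k"
  by (simp add: mp_coeff_def vec_eq_iff)

lemma mp_coeff_diff [simp]: "mp_coeff (P - Q) k = mp_coeff P k - mp_coeff Q k"
  by (simp add: mp_coeff_def vec_eq_iff)

lemma mp_coeff_sum [simp]: "mp_coeff (sum f S) k = (\<Sum>i\<in>S. mp_coeff (f i) k)"
  by (induction S rule: infinite_finite_induct) auto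

lemma mp_coeff_const_mult [simp]: "mp_coeff (mp_const A ** P) k = A ** mp_coeff P k"
  by (simp add: mp_coeff_def mp_const_def matrix_matrix_mult_def vec_eq_iff coeff_sum)

lemma mp_coeff_mat_monom:
  "mp_coeff (mat (monom 1 w) :: ('n::finite) mat_poly) k = (if k = w then mat 1 else 0)"
  by (auto simp: mp_coeff_def mat_def vec_eq_iff)

lemma mp_coeff_eventually_0: "\<exists>n. \<forall>k\<ge>n. mp_coeff P k = 0"
proof -
  define d where "d = (\<Sum>i\<in>UNIV. \<Sum>j\<in>UNIV. degree (P $ i $ j))"
  have "degree (P $ i $ j) \<le> d" for i j
  proof -
    have "degree (P $ i $ j) \<le> (\<Sum>j\<in>UNIV. degree (P $ i $ j))"
      by (rule member_le_sum) auto
    also have "\<dots> \<le> d"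
      unfolding d_def by (rule member_le_sum) auto
    finally show ?thesis .
  qed
  hence "coeff (P $ i $ j) k = 0" if "k \<ge> Suc d" for i j k
    using that by (metis Suc_le_eq coeff_eq_0 le_less_trans)
  hence "\<forall>k\<ge>Suc d. mp_coeff P k = 0"
    by (simp add: mp_coeff_def vec_eq_iff)
  thus ?thesis by blast
qed

lemma matrix_mult_zero_left [simp]: "0 ** (A :: 'a::semiring_1^'n^'m) = 0"
  and matrix_mult_zero_right [simp]: "(B :: 'a::semiring_1^'n^'m) ** 0 = 0"
  by (simp_all add: matrix_matrix_mult_def vec_eq_iff)

lemma mp_const_0 [simp]: "mp_const 0 = 0"
  by (simp add: mp_const_def vec_eq_iff)

lemma mp_const_diff_mult: "mp_const (A - B) ** (P :: ('n::finite) mat_poly) = mp_const A ** P - mp_const B ** P"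
  proof (rule mp_eqI)
  have "(A - B) ** X = A ** X - B ** X" for X
    by (simp add: matrix_matrix_mult_def vec_eq_iff left_diff_distrib sum_subtractf)
  thus "mp_coeff (mp_const (A - B) ** P) k = mp_coeff (mp_const A ** P - mp_const B ** P) k" for k
    by simp
qed

lemma mp_const_mult_assoc: "mp_const A ** (mp_const B ** (P :: ('n::finite) mat_poly)) = mp_const (A ** B) ** P"
  by (rule mp_eqI) (simp flip: matrix_mul_assoc)

text \<open>Compare the coefficients at \<open>w\<close>, where that of \<open>Q\<close> is the
  identity. This makes the eigenvalue matrix of an operator on \<open>Q\<close> unique.\<close>

lemma mp_const_monic_cancel:
  assumes "mp_monic w Q" "mp_const A ** Q = mp_const B ** Q"
  shows "A = B"
  using arg_cong[OF assms(2), of "\<lambda>P. mp_coeff P w"] assms(1)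
  by (simp add: mp_monic_def)

text \<open>Subtracting the top coefficient times \<open>Q n\<close> lowers the degree bound by one.
  Bounding the degree by vanishing coefficients lets the zero polynomial serve as base case
  \<open>n = 0\<close>.\<close>

lemma mp_monic_expansion:
  assumes "\<And>k. k < n \<Longrightarrow> mp_monic k (Q k)" and "\<And>k. k \<ge> n \<Longrightarrow> mp_coeff P k = 0"
  shows "\<exists>A. P = (\<Sum>k<n. mp_const (A k) ** Q k)"
  using assms
proof (induction n arbitrary: P)
  case 0
  thus ?case by (auto intro: mp_eqI)
next
  case (Suc n)
  let ?L = "mp_coeff P n"
  have "mp_coeff (P - mp_const ?L ** Q n) k = 0" if "k \<ge> n" for k
    using Suc.prems(1)[of n] Suc.prems(2)[of k] that
    by (cases "k = n") (auto simp: mp_monic_def)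
  then obtain A where A: "P - mp_const ?L ** Q n = (\<Sum>k<n. mp_const (A k) ** Q k)"
    using Suc.IH[of "P - mp_const ?L ** Q n"] Suc.prems(1) less_Suc_eq by metis
  have "(\<Sum>k<n. mp_const ((A(n := ?L)) k) ** Q k) = (\<Sum>k<n. mp_const (A k) ** Q k)"
    by (intro sum.cong) auto
  hence "(\<Sum>k<Suc n. mp_const ((A(n := ?L)) k) ** Q k) = P"
    by (simp flip: A)
  thus ?case by metis
qed

text \<open>In a sum over \<open>k < Suc n\<close>, only the last term has a coefficient of degree
  \<open>n\<close>, and that coefficient is \<open>A n\<close>; so the matrices vanish from the top
  down.\<close>

lemma mp_monic_independent:
  assumes "\<And>k. mp_monic k (Q k)" and "(\<Sum>k<n. mp_const (A k) ** Q k) = 0" and "k < n"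
  shows "A k = 0"
  using assms(2,3)
proof (induction n)
  case (Suc n)
  have "(\<Sum>k<n. A k ** mp_coeff (Q k) n) = 0"
    using assms(1) by (intro sum.neutral) (auto simp: mp_monic_def)
  moreover have "mp_coeff (\<Sum>k<Suc n. mp_const (A k) ** Q k) n = 0"
    using Suc.prems by simp
  ultimately have "A n = 0"
    using assms(1)[of n] by (simp add: mp_monic_def)
  thus ?case using Suc by (cases "k = n") auto
qed simp


section \<open>The matrix-valued form of a weight matrix\<close>

text \<open>Linear maps in finite dimension are bounded, hence commute with the integral. This
  serves for constant matrix factors, the conjugate transpose and single entries.\<close>

lemma
  fixes f :: "real \<Rightarrow> 'a::euclidean_space" and T :: "'a \<Rightarrow> 'b::euclidean_space"
  assumes "linear T" "set_integrable M S f"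
  shows set_integrable_linear: "set_integrable M S (\<lambda>x. T (f x))"
    and set_integral_linear: "(LINT x:S|M. T (f x)) = T (LINT x:S|M. f x)"
proof -
  have T: "bounded_linear T" using assms(1) by (simp add: linear_conv_bounded_linear)
  have "(\<lambda>x. indicator S x *\<^sub>R T (f x)) = (\<lambda>x. T (indicator S x *\<^sub>R f x))"
    by (simp add: linear_scale[OF assms(1)])
  thus "set_integrable M S (\<lambda>x. T (f x))" "(LINT x:S|M. T (f x)) = T (LINT x:S|M. f x)"
    using assms(2) integrable_bounded_linear[OF T] integral_bounded_linear[OF T]
    unfolding set_integrable_def set_lebesgue_integral_def by simp_all
qed

lemma linear_matrix_mult_left: "linear (\<lambda>X. (A :: ('n::finite) cmat) ** X)"
  by (rule linearI)
    (simp_all add: matrix_matrix_mult_def vec_eq_iff scaleR_sum_right distrib_left sum.distrib)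

lemma linear_matrix_mult_right: "linear (\<lambda>X. X ** (A :: ('n::finite) cmat))"
  by (rule linearI)
    (simp_all add: matrix_matrix_mult_def vec_eq_iff scaleR_sum_right distrib_right sum.distrib)

lemma linear_conj_transpose: "linear conj_transpose"
  by (rule linearI) (simp_all add: conj_transpose_def vec_eq_iff)

lemma linear_entry: "linear (\<lambda>X :: ('n::finite) cmat. X $ i $ j)"
  by (rule linearI) simp_all

lemma linear_axis_axis: "linear (\<lambda>z. axis i (axis j z) :: ('n::finite) cmat)"
  by (rule linearI) (auto simp: axis_def vec_eq_iff)

text \<open>Rebuilding a matrix from its entries reduces integrability of a matrix function to that
  of its entries.\<close>

lemma cmat_axis_sum: "(\<Sum>i\<in>UNIV. \<Sum>j\<in>UNIV. axis i (axis j (X $ i $ j))) = (X :: ('n::finite) cmat)"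
proof -
  have "(\<Sum>i\<in>UNIV. \<Sum>j\<in>UNIV. axis i (axis j (X $ i $ j)) $ r $ s) =
      (\<Sum>i\<in>UNIV. if i = r then (\<Sum>j\<in>UNIV. if j = s then X $ i $ j else 0) else 0)" for r s
    by (intro sum.cong refl) (auto simp: axis_def intro!: sum.cong)
  thus ?thesis by (simp add: vec_eq_iff)
qed

lemma conj_transpose_mult: "conj_transpose (A ** B) = conj_transpose B ** conj_transpose A"
  by (simp add: conj_transpose_def matrix_matrix_mult_def vec_eq_iff mult.commute)

lemma conj_transpose_conj_transpose [simp]: "conj_transpose (conj_transpose A) = A"
  by (simp add: conj_transpose_def vec_eq_iff)

lemma conj_transpose_0 [simp]: "conj_transpose 0 = 0"
  by (simp add: conj_transpose_def vec_eq_iff)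

lemma conj_transpose_add: "conj_transpose (A + B) = conj_transpose A + conj_transpose B"
  by (simp add: conj_transpose_def vec_eq_iff)

lemma mp_eval_add: "mp_eval (P + Q) x = mp_eval P x + mp_eval Q x"
  by (simp add: mp_eval_def vec_eq_iff)

lemma mp_eval_const_mult: "mp_eval (mp_const A ** P) x = A ** mp_eval P x"
  by (simp add: mp_eval_def mp_const_def matrix_matrix_mult_def vec_eq_iff poly_sum)

lemma mp_form_integrand_entry:
  "(mp_eval P x ** W ** conj_transpose (mp_eval Q x)) $ i $ j =
     (\<Sum>l\<in>UNIV. \<Sum>k\<in>UNIV. poly (P $ i $ k) (of_real x) * W $ k $ l * cnj (poly (Q $ j $ l) (of_real x)))"
  by (simp add: matrix_matrix_mult_def mp_eval_def conj_transpose_def sum_distrib_right)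

context
  fixes a b :: ereal and W :: "real \<Rightarrow> ('n::finite) cmat"
  assumes W: "weight_matrix a b W"
begin

text \<open>A polynomial times \<open>W\<close> is a finite combination of the integrands
  \<open>x ^ i *\<^sub>R W x\<close> of the moments.\<close>

lemma set_integrable_poly_weight:
  "set_integrable lebesgue (einterval a b) (\<lambda>x. poly r (of_real x) * W x $ k $ l)"
proof -
  have "set_integrable lebesgue (einterval a b) (\<lambda>x. coeff r i * (x ^ i *\<^sub>R W x) $ k $ l)" for i
    using W unfolding weight_matrix_def
    by (intro set_integrable_mult_right set_integrable_linear[OF linear_entry]) auto
  hence "set_integrable lebesgue (einterval a b)
      (\<lambda>x. \<Sum>i\<le>degree r. coeff r i * (x ^ i *\<^sub>R W x) $ k $ l)"
    unfolding set_integrable_def scaleR_sum_right by (intro Bochner_Integration.integrable_sum)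
  moreover have "(\<Sum>i\<le>degree r. coeff r i * (x ^ i *\<^sub>R W x) $ k $ l) = poly r (of_real x) * W x $ k $ l" for x
    unfolding vector_scaleR_component poly_altdef sum_distrib_right
    by (intro sum.cong refl) (simp add: scaleR_conv_of_real)
  ultimately show ?thesis by simp
qed

lemma set_integrable_mp_form:
  "set_integrable lebesgue (einterval a b) (\<lambda>x. mp_eval P x ** W x ** conj_transpose (mp_eval Q x))"
proof -
  let ?F = "\<lambda>x. mp_eval P x ** W x ** conj_transpose (mp_eval Q x)"
  \<comment> \<open>At a real point, conjugating the value amounts to conjugating the coefficients,
    so each summand of an entry becomes one polynomial times an entry of \<open>W\<close>.\<close>
  have cnj_poly: "cnj (poly q (of_real x)) = poly (map_poly cnj q) (of_real x)" for q x
    using poly_cnj[of q "of_real x"] by simp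
  have "set_integrable lebesgue (einterval a b)
      (\<lambda>x. poly (P $ i $ k) (of_real x) * W x $ k $ l * cnj (poly (Q $ j $ l) (of_real x)))" for i j k l
    using set_integrable_poly_weight[of "P $ i $ k * map_poly cnj (Q $ j $ l)" k l]
    by (simp only: cnj_poly poly_mult mult_ac)
  hence "set_integrable lebesgue (einterval a b) (\<lambda>x. ?F x $ i $ j)" for i j
    unfolding mp_form_integrand_entry set_integrable_def scaleR_sum_right
    by (intro Bochner_Integration.integrable_sum)
  hence "set_integrable lebesgue (einterval a b) (\<lambda>x. axis i (axis j (?F x $ i $ j)) :: 'n cmat)" for i j
    by (rule set_integrable_linear[OF linear_axis_axis])
  hence "set_integrable lebesgue (einterval a b)
      (\<lambda>x. \<Sum>i\<in>UNIV. \<Sum>j\<in>UNIV. axis i (axis j (?F x $ i $ j)) :: 'n cmat)"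
    unfolding set_integrable_def scaleR_sum_right
    by (intro Bochner_Integration.integrable_sum)
  thus ?thesis by (simp add: cmat_axis_sum)
qed

lemma mp_form_const_left: "mp_form a b W (mp_const A ** P) Q = A ** mp_form a b W P Q"
  unfolding mp_form_def set_integral_linear[OF linear_matrix_mult_left set_integrable_mp_form, symmetric]
  by (simp add: mp_eval_const_mult matrix_mul_assoc)

lemma mp_form_const_right:
  "mp_form a b W P (mp_const A ** Q) = mp_form a b W P Q ** conj_transpose A"
  unfolding mp_form_def set_integral_linear[OF linear_matrix_mult_right set_integrable_mp_form, symmetric]
  by (simp add: mp_eval_const_mult conj_transpose_mult matrix_mul_assoc)

lemma mp_form_add_left: "mp_form a b W (P + P') Q = mp_form a b W P Q + mp_form a b W P' Q"
  unfolding mp_form_def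
  by (simp add: mp_eval_add matrix_add_rdistrib' set_integral_add(2)[OF set_integrable_mp_form set_integrable_mp_form])

lemma mp_form_add_right: "mp_form a b W P (Q + Q') = mp_form a b W P Q + mp_form a b W P Q'"
  unfolding mp_form_def
  by (simp add: mp_eval_add conj_transpose_add matrix_add_ldistrib
      set_integral_add(2)[OF set_integrable_mp_form set_integrable_mp_form])

lemma mp_form_0_left [simp]: "mp_form a b W 0 Q = 0"
  using mp_form_const_left[of 0 0 Q] by simp

lemma mp_form_0_right [simp]: "mp_form a b W P 0 = 0"
  using mp_form_const_right[of P 0 0] by simp

lemma mp_form_sum_left: "mp_form a b W (sum f S) Q = (\<Sum>i\<in>S. mp_form a b W (f i) Q)"
  by (induction S rule: infinite_finite_induct) (auto simp: mp_form_add_left)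

lemma mp_form_sum_right: "mp_form a b W P (sum f S) = (\<Sum>i\<in>S. mp_form a b W P (f i))"
  by (induction S rule: infinite_finite_induct) (auto simp: mp_form_add_right)

lemma mp_form_diff_left: "mp_form a b W (P - P') Q = mp_form a b W P Q - mp_form a b W P' Q"
  using mp_form_add_left[of "P - P'" P' Q] by (simp add: algebra_simps)

text \<open>\<open>W x\<close> is Hermitian only almost everywhere, so the two integrands are
  compared almost everywhere.\<close>

lemma mp_form_hermitian: "mp_form a b W Q P = conj_transpose (mp_form a b W P Q)"
proof -
  have AE: "AE x in lebesgue. x \<in> einterval a b \<longrightarrow>
      mp_eval Q x ** W x ** conj_transpose (mp_eval P x) =
      conj_transpose (mp_eval P x ** W x ** conj_transpose (mp_eval Q x))"
    using W unfolding weight_matrix_def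
    by (elim conjE, elim AE_mp)
       (auto intro!: AE_I2 simp: conj_transpose_mult matrix_mul_assoc positive_definite_def)
  have "mp_form a b W Q P =
      (LINT x:einterval a b|lebesgue. conj_transpose (mp_eval P x ** W x ** conj_transpose (mp_eval Q x)))"
    unfolding mp_form_def set_lebesgue_integral_def
  proof (rule integral_cong_AE)
    show "AE x in lebesgue.
        indicat_real (einterval a b) x *\<^sub>R (mp_eval Q x ** W x ** conj_transpose (mp_eval P x)) =
        indicat_real (einterval a b) x *\<^sub>R
          conj_transpose (mp_eval P x ** W x ** conj_transpose (mp_eval Q x))"
      using AE by eventually_elim (auto simp: indicator_def)
  qed (use set_integrable_mp_form set_integrable_linear[OF linear_conj_transpose set_integrable_mp_form]
       in \<open>auto simp: set_integrable_def\<close>)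
  thus ?thesis
    by (simp add: mp_form_def set_integral_linear[OF linear_conj_transpose set_integrable_mp_form])
qed

text \<open>The \<open>i\<close>-th diagonal entry of the integrand is the quadratic form of
  \<open>W x\<close> at the conjugated \<open>i\<close>-th row of \<open>P\<close>. Its integral
  vanishes, so that row is zero almost everywhere on the interval, which no nonzero polynomial entry
  allows.\<close>

lemma mp_form_definite:
  assumes "mp_form a b W P P = 0"
  shows "P = 0"
proof -
  let ?F = "\<lambda>x. mp_eval P x ** W x ** conj_transpose (mp_eval P x)"
  \<comment> \<open>the double conjugate puts the sum in the shape of \<open>positive_definite\<close>\<close>
  have F_Re: "Re (?F x $ i $ i) = Re (\<Sum>k\<in>UNIV. \<Sum>l\<in>UNIV.
      cnj (cnj (mp_eval P x $ i $ k)) * W x $ k $ l * cnj (mp_eval P x $ i $ l))" for x i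
    by (subst mp_form_integrand_entry, subst sum.swap) (simp add: mp_eval_def)
  have pos: "Re (?F x $ i $ i) > 0" if "positive_definite (W x)" "mp_eval P x $ i \<noteq> 0" for x i
  proof -
    have "(\<chi> k. cnj (mp_eval P x $ i $ k)) \<noteq> 0"
      using that(2) by (simp add: vec_eq_iff)
    with that(1) have "0 < Re (\<Sum>k\<in>UNIV. \<Sum>l\<in>UNIV. cnj ((\<chi> k. cnj (mp_eval P x $ i $ k)) $ k) *
        W x $ k $ l * (\<chi> k. cnj (mp_eval P x $ i $ k)) $ l)"
      unfolding positive_definite_def by blast
    thus ?thesis unfolding F_Re by simp
  qed
  have nonneg: "Re (?F x $ i $ i) \<ge> 0" if "positive_definite (W x)" for x i
    using pos[OF that, of i] by (cases "mp_eval P x $ i = 0") (auto simp: F_Re)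
  have AE_W: "AE x in lebesgue. x \<in> einterval a b \<longrightarrow> positive_definite (W x)"
    using W by (simp add: weight_matrix_def)
  have "P $ i $ j = 0" for i j
  proof (rule ccontr)
    assume nz: "P $ i $ j \<noteq> 0"
    have lin: "linear (\<lambda>X :: 'n cmat. Re (X $ i $ i))"
      by (rule linearI) simp_all
    let ?g = "\<lambda>x. indicat_real (einterval a b) x *\<^sub>R Re (?F x $ i $ i)"
    have int: "integrable lebesgue ?g"
      using set_integrable_linear[OF lin set_integrable_mp_form] by (simp add: set_integrable_def)
    have "integral\<^sup>L lebesgue ?g = 0"
      using assms set_integral_linear[OF lin set_integrable_mp_form, of P P]
      by (simp add: mp_form_def set_lebesgue_integral_def)
    moreover have "AE x in lebesgue. 0 \<le> ?g x"
      using AE_W by eventually_elim (use nonneg in \<open>auto simp: indicator_def\<close>)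
    ultimately have "AE x in lebesgue. ?g x = 0"
      using integral_nonneg_eq_0_iff_AE[OF int] by simp
    hence "AE x in lebesgue. x \<notin> einterval a b \<inter> {x. poly (P $ i $ j) (of_real x) \<noteq> 0}"
      using AE_W
    proof eventually_elim
      case (elim x)
      have "mp_eval P x $ i = 0" if "x \<in> einterval a b"
        using elim pos[of x i] that by force
      thus ?case by (auto simp: mp_eval_def vec_eq_iff)
    qed
    moreover have "finite {x :: real. poly (P $ i $ j) (of_real x) = 0}"
    proof -
      \<comment> \<open>Finiteness is known for complex roots; the real ones embed injectively among
        them.\<close>
      have "finite (complex_of_real ` {x. poly (P $ i $ j) (of_real x) = 0})"
        using poly_roots_finite[OF nz] by (rule rev_finite_subset) auto
      thus ?thesis by (rule finite_imageD) (auto intro: inj_onI)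
    qed
    hence "AE x in lebesgue. x \<notin> {x. poly (P $ i $ j) (of_real x) = 0}"
      by (intro AE_not_in) (simp add: negligible_finite flip: negligible_iff_null_sets)
    \<comment> \<open>Almost every point of the interval is a root, yet almost no point is one; so
      the nonempty open interval would be negligible.\<close>
    ultimately have "AE x in lebesgue. x \<notin> einterval a b"
      by eventually_elim auto
    hence "negligible (einterval a b)"
      by (simp add: negligible_iff_null_sets AE_iff_null_sets)
    moreover have "einterval a b \<noteq> {}"
      using W ereal_dense2[of a b] by (auto simp: weight_matrix_def einterval_def)
    ultimately show False
      using open_not_negligible[of "einterval a b"] by (simp add: open_einterval)
  qed
  thus ?thesis by (simp add: vec_eq_iff)
qed

text \<open>A left null vector of \<open>?S\<close>, repeated in every row of \<open>A\<close>,
  gives \<open>(A P, A P) = A ?S A* = 0\<close>. Definiteness yields \<open>A P = 0\<close>, and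
  \<open>P\<close> is monic, so \<open>A = 0\<close>.\<close>

lemma mp_form_monic_invertible:
  assumes "mp_monic w P"
  shows "invertible (mp_form a b W P P)"
proof -
  let ?S = "mp_form a b W P P"
  have "v = 0" if "transpose ?S *v v = 0" for v
  proof -
    define A :: "'n cmat" where "A = (\<chi> i. v)"
    have "A ** ?S = 0"
      using that
      by (simp add: A_def matrix_matrix_mult_def matrix_vector_mult_def transpose_def vec_eq_iff mult.commute)
    hence "mp_form a b W (mp_const A ** P) (mp_const A ** P) = 0"
      by (simp add: mp_form_const_left mp_form_const_right matrix_mul_assoc)
    hence "mp_const A ** P = mp_const 0 ** P"
      using mp_form_definite by simp
    with assms have "A = 0" by (rule mp_const_monic_cancel)
    thus "v = 0" by (simp add: A_def vec_eq_iff)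
  qed
  hence "invertible (transpose ?S)"
    by (simp add: invertible_left_inverse matrix_left_invertible_ker)
  thus ?thesis
    by (simp add: invertible_det_nz det_transpose)
qed

section \<open>Existence and uniqueness of the monic orthogonal polynomials\<close>

lemma mp_form_eq_0_below:
  assumes "\<And>k. k < w \<Longrightarrow> mp_monic k (Q k)" "\<And>k. k < w \<Longrightarrow> mp_form a b W P (Q k) = 0"
    and "\<And>k. k \<ge> w \<Longrightarrow> mp_coeff R k = 0"
  shows "mp_form a b W P R = 0"
proof -
  obtain A where "R = (\<Sum>k<w. mp_const (A k) ** Q k)"
    using mp_monic_expansion[of w Q R] assms by blast
  thus ?thesis by (simp add: mp_form_sum_right mp_form_const_right assms(2))
qed

text \<open>Gram-Schmidt. Requiring orthogonality to every polynomial of lower degree, not just to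
  earlier members of a sequence, lets the induction hypothesis supply each \<open>Q k\<close>
  independently.\<close>

lemma monic_orthogonal_below_exists:
  "\<exists>P. mp_monic w P \<and> (\<forall>R. (\<forall>k\<ge>w. mp_coeff R k = 0) \<longrightarrow> mp_form a b W P R = 0)"
proof (induction w rule: less_induct)
  case (less w)
  then obtain Q where monic: "mp_monic k (Q k)"
    and orth: "(\<And>j. j \<ge> k \<Longrightarrow> mp_coeff R j = 0) \<Longrightarrow> mp_form a b W (Q k) R = 0"
    if "k < w" for k R by metis
  \<comment> \<open>The member of higher index is orthogonal to the other; Hermitian symmetry covers
    the opposite order.\<close>
  have orth': "mp_form a b W (Q k) (Q l) = 0" if "k < w" "l < w" "k \<noteq> l" for k l
  proof (cases "l < k")
    case True
    thus ?thesis using orth[of k "Q l"] monic[of l] that by (simp add: mp_monic_def)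
  next
    case False
    hence "mp_form a b W (Q l) (Q k) = 0"
      using orth[of l "Q k"] monic[of k] that by (simp add: mp_monic_def)
    thus ?thesis using mp_form_hermitian[of "Q k" "Q l"] by simp
  qed
  let ?X = "mat (monom 1 w) :: 'n mat_poly"
  obtain B where B: "B k ** mp_form a b W (Q k) (Q k) = mat 1" if "k < w" for k
    using mp_form_monic_invertible[OF monic] unfolding invertible_left_inverse by metis
  \<comment> \<open>The projection coefficient \<open>(X, Q k) (Q k, Q k)^-1\<close>; the inverse
    stands on the right because constants leave the first argument on the left.\<close>
  define A where "A k = mp_form a b W ?X (Q k) ** B k" for k
  define P where "P = ?X - (\<Sum>k<w. mp_const (A k) ** Q k)"
  have "mp_monic w P"
    unfolding mp_monic_def P_def using monic
    by (auto simp: mp_coeff_mat_monom mp_monic_def intro!: sum.neutral)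
  moreover have "mp_form a b W P (Q l) = 0" if "l < w" for l
  proof -
    have "(\<Sum>k<w. A k ** mp_form a b W (Q k) (Q l)) =
        (\<Sum>k<w. if k = l then A l ** mp_form a b W (Q l) (Q l) else 0)"
      using that orth' by (intro sum.cong) auto
    also have "\<dots> = mp_form a b W ?X (Q l)"
      using that by (simp add: A_def B flip: matrix_mul_assoc)
    finally show ?thesis
      by (simp add: P_def mp_form_diff_left mp_form_sum_left mp_form_const_left)
  qed
  hence "mp_form a b W P R = 0" if "\<forall>k\<ge>w. mp_coeff R k = 0" for R
    using mp_form_eq_0_below[of w Q P R] monic that by blast
  ultimately show ?case by blast
qed

text \<open>The leading terms of \<open>Q w\<close> and \<open>Q' w\<close> cancel, so their
  difference has degree below \<open>w\<close>. Both are orthogonal to it, hence it is orthogonal to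
  itself.\<close>

lemma is_monic_ops_unique:
  assumes "is_monic_ops a b W Q" "is_monic_ops a b W Q'"
  shows "Q = Q'"
proof
  fix w
  have *: "mp_form a b W (R w) S = 0"
    if "is_monic_ops a b W R" "\<And>k. k \<ge> w \<Longrightarrow> mp_coeff S k = 0" for R S
    by (rule mp_form_eq_0_below[of w R]) (use that in \<open>auto simp: is_monic_ops_def\<close>)
  have "mp_coeff (Q w - Q' w) k = 0" if "k \<ge> w" for k
  proof -
    have "mp_monic w (Q w)" "mp_monic w (Q' w)"
      using assms unfolding is_monic_ops_def by blast+
    thus ?thesis
      using that by (cases "k = w") (auto simp: mp_monic_def)
  qed
  hence "mp_form a b W (Q w - Q' w) (Q w - Q' w) = 0"
    using *[OF assms(1)] *[OF assms(2)] by (simp add: mp_form_diff_left)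
  thus "Q w = Q' w" using mp_form_definite by fastforce
qed

text \<open>Existence and uniqueness together justify the definite description in
  \<open>monic_ops\<close>.\<close>

lemma is_monic_ops_monic_ops: "is_monic_ops a b W (monic_ops a b W)"
proof -
  obtain Q where monic: "\<And>w. mp_monic w (Q w)"
    and orth: "\<And>w R. (\<And>k. k \<ge> w \<Longrightarrow> mp_coeff R k = 0) \<Longrightarrow> mp_form a b W (Q w) R = 0"
    using monic_orthogonal_below_exists by metis
  have less: "mp_form a b W (Q w) (Q w') = 0" if "w' < w" for w w'
    using orth[of w "Q w'"] monic[of w'] that by (simp add: mp_monic_def)
  hence "mp_form a b W (Q w) (Q w') = 0" if "w \<noteq> w'" for w w'
    using that mp_form_hermitian[of "Q w" "Q w'"] by (cases "w' < w") auto
  with monic have "is_monic_ops a b W Q" by (simp add: is_monic_ops_def)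
  thus ?thesis unfolding monic_ops_def
    using is_monic_ops_unique by (intro theI[of "is_monic_ops a b W"])
qed

lemma mp_monic_monic_ops: "mp_monic w (monic_ops a b W w)"
  using is_monic_ops_monic_ops by (simp add: is_monic_ops_def)

lemma weyl_act_monic_ops:
  assumes "D \<in> D_alg a b W"
  shows "weyl_act (monic_ops a b W w) D = mp_const (Lambda a b W w D) ** monic_ops a b W w"
proof -
  from assms obtain L where L: "weyl_act (monic_ops a b W w) D = mp_const L ** monic_ops a b W w"
    unfolding D_alg_def by blast
  show ?thesis unfolding Lambda_def
    by (rule theI, rule L) (metis L mp_const_monic_cancel mp_monic_monic_ops)
qed

end


section \<open>The centralizer of the center\<close>

lemma weyl_act_add_left: "weyl_act (P + Q) D = weyl_act P D + weyl_act Q D"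
  by (simp add: weyl_act_def mp_deriv_funpow_add matrix_add_rdistrib' sum.distrib)

lemma weyl_act_0_left [simp]: "weyl_act 0 D = 0"
  by (simp add: weyl_act_def)

lemma weyl_act_sum_left: "weyl_act (sum f S) D = (\<Sum>i\<in>S. weyl_act (f i) D)"
  by (induction S rule: infinite_finite_induct) (auto simp: weyl_act_add_left)

lemma mp_deriv_const_mult: "mp_deriv (mp_const A ** P) = mp_const A ** mp_deriv P"
proof -
  have "mp_deriv (mp_const A) = 0"
    by (simp add: mp_deriv_def mp_const_def vec_eq_iff)
  thus ?thesis by (simp add: mp_deriv_mult)
qed

lemma mp_deriv_funpow_const_mult: "(mp_deriv ^^ n) (mp_const A ** P) = mp_const A ** (mp_deriv ^^ n) P"
  by (induction n) (auto simp: mp_deriv_const_mult)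

text \<open>Operators act on the right and constants have zero derivative, so the action is linear
  over left multiplication by constant matrices.\<close>

lemma weyl_act_const_mult: "weyl_act (mp_const A ** P) D = mp_const A ** weyl_act P D"
  by (simp add: weyl_act_def mp_deriv_funpow_const_mult matrix_sum_right matrix_mul_assoc)

theorem theorem7p2:
  fixes a b :: ereal and W :: "real \<Rightarrow> complex ^ 'n ^ 'n"
  assumes "weight_matrix a b W"
    and "\<And>n. \<exists>C \<in> center (D_alg a b W).
           (\<forall>k. scalar_matrix (Lambda a b W k C)) \<and>
           (\<forall>k. Lambda a b W k C = Lambda a b W n C \<longrightarrow> k = n)"
  shows "centralizer (center (D_alg a b W)) = D_alg a b W"
proof
  show "D_alg a b W \<subseteq> centralizer (center (D_alg a b W))"
    by (auto simp: centralizer_def center_def)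
next
  let ?Q = "monic_ops a b W"
  note monic = mp_monic_monic_ops[OF assms(1)]
  show "centralizer (center (D_alg a b W)) \<subseteq> D_alg a b W"
  proof
    fix D assume D: "D \<in> centralizer (center (D_alg a b W))"
    have "\<exists>L. weyl_act (?Q n) D = mp_const L ** ?Q n" for n
    proof -
      obtain C where C: "C \<in> center (D_alg a b W)"
        and scalar: "\<And>k. scalar_matrix (Lambda a b W k C)"
        and sep: "\<And>k. Lambda a b W k C = Lambda a b W n C \<Longrightarrow> k = n"
        using assms(2)[of n] by blast
      obtain c where c: "Lambda a b W k C = mat (c k)" for k
        using scalar unfolding scalar_matrix_def by metis
      have act_C: "weyl_act (?Q k) C = mp_const (mat (c k)) ** ?Q k" for k
        using weyl_act_monic_ops[OF assms(1), of C k] C by (simp add: center_def c)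
      \<comment> \<open>Acting by \<open>C\<close> on \<open>A k\<close> times \<open>?Q k\<close>
        puts \<open>c k\<close> to the right of \<open>A k\<close>. Being scalar, it can move to the
        left, where \<open>c n\<close> stands in the other expansion.\<close>
      have scal_comm: "A ** mat z = mat z ** A" for A :: "'n cmat" and z
        by (simp add: matrix_matrix_mult_def mat_def vec_eq_iff if_distrib if_distribR cong: if_cong)
      let ?P = "weyl_act (?Q n) D"
      obtain m where "\<forall>k\<ge>m. mp_coeff ?P k = 0"
        using mp_coeff_eventually_0 by blast
      then obtain A where A: "?P = (\<Sum>k<m. mp_const (A k) ** ?Q k)"
        using mp_monic_expansion[of m ?Q ?P] monic by blast
      \<comment> \<open>\<open>D\<close> commutes with the central \<open>C\<close>, so
        \<open>Q_n D C\<close> can be computed in either order and the expansions compared.\<close>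
      have "weyl_act ?P C = weyl_act (weyl_act (?Q n) C) D"
        using C D by (simp add: centralizer_def flip: weyl_act_mult)
      also have "\<dots> = (\<Sum>k<m. mp_const (mat (c n) ** A k) ** ?Q k)"
        by (simp add: act_C weyl_act_const_mult A matrix_sum_right mp_const_mult_assoc)
      finally have "(\<Sum>k<m. mp_const (mat (c k) ** A k) ** ?Q k) =
          (\<Sum>k<m. mp_const (mat (c n) ** A k) ** ?Q k)"
        by (simp add: A weyl_act_sum_left weyl_act_const_mult act_C mp_const_mult_assoc scal_comm)
      hence sum_0: "(\<Sum>k<m. mp_const (mat (c k) ** A k - mat (c n) ** A k) ** ?Q k) = 0"
        by (simp add: mp_const_diff_mult sum_subtractf)
      have A_0: "A k = 0" if "k < m" "k \<noteq> n" for k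
      proof -
        have "mat (c k) ** A k - mat (c n) ** A k = 0"
          by (rule mp_monic_independent[OF monic sum_0 that(1)])
        moreover have "c k \<noteq> c n" using sep[of k] that(2) by (auto simp: c)
        ultimately show ?thesis by (auto simp: mat_mult_left vec_eq_iff)
      qed
      have "?P = (\<Sum>k<m. if k = n then mp_const (A n) ** ?Q n else 0)"
        unfolding A using A_0 by (intro sum.cong) auto
      \<comment> \<open>If \<open>n\<close> lies outside the range of the expansion, every term
        vanishes and the eigenvalue is zero.\<close>
      hence "?P = mp_const (if n < m then A n else 0) ** ?Q n"
        by simp
      thus ?thesis by blast
    qed
    thus "D \<in> D_alg a b W" by (simp add: D_alg_def)
  qed
qed

end
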